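(* Let $G$ be a graph and $T$ a tree, each with a vertex labeled $v$, and let $G\stackrel{v}{+}T$ be their vertex-sum at $v$. Then $Z_+(G\stackrel{v}{+}T)=Z_+(G)$ and $\mathrm{T}(G\stackrel{v}{+}T)=\mathrm{T}(G)$.
   Context: All graphs are finite, simple and undirected. Positive semidefinite colour change rule: vertices are coloured black or white; let $B$ be the set of black vertices and $W_1,\dots,W_r$ the vertex sets of the components of $G-B$; if $u\in B$ and $w\in W_i$ is the only white neighbour of $u$ in the subgraph induced by $B\cup W_i$, then $w$ is recoloured black. A positive zero forcing set is a set of initially black vertices (all others white) from which repeated application of this rule colours all vertices black; $Z_+(G)$ is the minimum size of such a set. The tree cover number $\mathrm{T}(G)$ is the minimum number of vertex-disjoint induced trees of $G$ covering $V(G)$. The vertex-sum $G\stackrel{v}{+}H$ is obtained from disjoint copies of $G$ and $H$ by identifying their vertices labeled $v$. *)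

theory Defs
  imports "Graph_Theory.Digraph_Component" "HOL-Library.Disjoint_Sets"
begin

text \<open>
  Finite simple undirected graphs are finite, loop-free, symmetric digraphs without parallel arcs:
  the locale \<open>pair_graph\<close> (or \<open>graph\<close>) of the library, where an edge is a pair of opposite arcs.
  All notions below are intended for such graphs only.

  The library predicates \<open>forest\<close> and \<open>tree\<close> cannot be used here: they regard the walk
  \<open>a, b, a\<close> along an edge and back as a cycle, so that a symmetric digraph with an edge is never
  a \<open>tree\<close>.  In a simple undirected graph a cycle has at least three edges; with that condition
  the library's \<open>cycle\<close> (a closed walk whose vertices are distinct, apart from the two ends
  coinciding) is the usual notion.
\<close>

definition undirected_tree :: "('a, 'b) pre_digraph \<Rightarrow> bool" where
  "undirected_tree G \<longleftrightarrow>
     connected G \<and> \<not> (\<exists>p. pre_digraph.cycle G p \<and> 3 \<le> length p)"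


text \<open>
  \<open>B\<close> is the set of black vertices.  As \<open>G\<close> is symmetric, the strongly connected components
  of \<open>G - B\<close> are its components.
\<close>

definition psd_forces :: "('a, 'b) pre_digraph \<Rightarrow> 'a set \<Rightarrow> 'a \<Rightarrow> 'a \<Rightarrow> bool" where
  "psd_forces G B u w \<longleftrightarrow> u \<in> B \<and>
     (\<exists>W \<in> pre_digraph.sccs_verts (G \<restriction> (verts G - B)).
        w \<in> W \<and> {x. x \<notin> B \<and> u \<rightarrow>\<^bsub>G \<restriction> (B \<union> W)\<^esub> x} = {w})"

definition psd_step :: "('a, 'b) pre_digraph \<Rightarrow> 'a set \<Rightarrow> 'a set \<Rightarrow> bool" where
  "psd_step G B B' \<longleftrightarrow> (\<exists>u w. psd_forces G B u w \<and> B' = insert w B)"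

definition positive_zero_forcing_set :: "('a, 'b) pre_digraph \<Rightarrow> 'a set \<Rightarrow> bool" where
  "positive_zero_forcing_set G B \<longleftrightarrow> B \<subseteq> verts G \<and> (psd_step G)\<^sup>*\<^sup>* B (verts G)"

definition Z_plus :: "('a, 'b) pre_digraph \<Rightarrow> nat" where
  "Z_plus G = (LEAST k. \<exists>B. positive_zero_forcing_set G B \<and> card B = k)"


text \<open>An induced tree is given by its vertex set.\<close>

definition induced_tree_cover :: "('a, 'b) pre_digraph \<Rightarrow> 'a set set \<Rightarrow> bool" where
  "induced_tree_cover G P \<longleftrightarrow>
     partition_on (verts G) P \<and> (\<forall>X \<in> P. undirected_tree (G \<restriction> X))"

definition tree_cover_number :: "('a, 'b) pre_digraph \<Rightarrow> nat" where
  "tree_cover_number G = (LEAST k. \<exists>P. induced_tree_cover G P \<and> card P = k)"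


text \<open>
  The vertex-sum of \<open>G\<close> and \<open>H\<close>, where \<open>v\<close> is the vertex of \<open>G\<close> and \<open>w\<close> the vertex of \<open>H\<close> carrying
  the common label.  The sum type provides the disjoint copies, and \<open>glue v w\<close> embeds the vertices
  of \<open>H\<close> with \<open>w\<close> identified with \<open>v\<close>.
\<close>

definition glue :: "'a \<Rightarrow> 'b \<Rightarrow> 'b \<Rightarrow> 'a + 'b" where
  "glue v w y = (if y = w then Inl v else Inr y)"

definition vertex_sum ::
    "'a pair_pre_digraph \<Rightarrow> 'a \<Rightarrow> 'b pair_pre_digraph \<Rightarrow> 'b \<Rightarrow> ('a + 'b) pair_pre_digraph" where
  "vertex_sum G v H w =
     \<lparr> pverts = Inl ` pverts G \<union> glue v w ` pverts H,
       parcs = map_prod Inl Inl ` parcs G \<union> map_prod (glue v w) (glue v w) ` parcs H \<rparr>"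

lemma inj_glue: "inj (glue v w)"
  by (auto simp: inj_def glue_def)

lemma pair_graph_vertex_sum:
  assumes "pair_graph G" "pair_graph H"
  shows "pair_graph (vertex_sum G v H w)"
proof -
  interpret G: pair_graph G by fact
  interpret H: pair_graph H by fact
  have symG: "(b, a) \<in> parcs G" if "(a, b) \<in> parcs G" for a b
    using that by (rule G.arcs_symmetric)
  have symH: "(b, a) \<in> parcs H" if "(a, b) \<in> parcs H" for a b
    using that by (rule H.arcs_symmetric)
  show ?thesis
  proof
    show "symmetric (with_proj (vertex_sum G v H w))"
      by (auto simp: symmetric_def vertex_sum_def sym_def map_prod_def image_iff
          dest: symG symH)
         (metis symG symH case_prod_conv)+
  next
    fix e assume "e \<in> parcs (vertex_sum G v H w)"
    then show "fst e \<noteq> snd e"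
      by (auto simp: vertex_sum_def inj_eq[OF inj_glue] dest: G.no_loops' H.no_loops')
  qed (auto simp: vertex_sum_def dest: G.wellformed' H.wellformed'
        intro: G.pair_finite_verts H.pair_finite_verts G.pair_finite_arcs H.pair_finite_arcs)
qed

end

theory Submission
  imports Defs
begin

text \<open>
  Write \<open>A\<close> and \<open>C\<close> for the vertex sets of \<open>G\<close> and \<open>T\<close> inside the vertex-sum, so that
  \<open>A \<inter> C = {v}\<close>.  Collapsing \<open>C\<close> to \<open>v\<close> retracts walks of the sum to walks of \<open>G\<close>.

  Zero forcing: a forcing set of \<open>G\<close> still forces all of \<open>A\<close> in the sum, and then every edge from a
  black to a white vertex of the tree is a force, since a second white neighbour in the same
  component would close a cycle.  Conversely, in a forcing set of the sum replace all vertices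
  outside \<open>A\<close> by the single vertex \<open>v\<close>; the forces inside \<open>A\<close> remain valid, because more
  black vertices only shrink components.

  Tree covers: the tree through \<open>v\<close> of a cover of \<open>G\<close> absorbs \<open>C\<close>, and the trees of a cover of the
  sum meet \<open>A\<close> in trees.
\<close>

text \<open>
  The last conjunct excludes cycles through \<open>a\<close>: two neighbours of \<open>a\<close> joined by a walk avoiding
  \<open>a\<close> are equal.
\<close>

definition is_tree_on :: "'a set \<Rightarrow> 'a rel \<Rightarrow> bool" where
  "is_tree_on X E \<longleftrightarrow> X \<noteq> {} \<and> (\<forall>x\<in>X. \<forall>y\<in>X. (x, y) \<in> rtrancl_on X E) \<and>
     (\<forall>a\<in>X. \<forall>x y. (a, x) \<in> E \<longrightarrow> (a, y) \<in> E \<longrightarrow> (x, y) \<in> rtrancl_on (X - {a}) E \<longrightarrow> x = y)"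

text \<open>The component of \<open>w\<close> in \<open>V - B\<close> is the set of \<open>x\<close> with \<open>(w, x) \<in> rtrancl_on (V - B) E\<close>.\<close>

definition forces_on :: "'a set \<Rightarrow> 'a rel \<Rightarrow> 'a set \<Rightarrow> 'a \<Rightarrow> 'a \<Rightarrow> bool" where
  "forces_on V E B u w \<longleftrightarrow> u \<in> B \<and> w \<in> V - B \<and> (u, w) \<in> E \<and>
     (\<forall>x. (u, x) \<in> E \<longrightarrow> (w, x) \<in> rtrancl_on (V - B) E \<longrightarrow> x = w)"

definition step_on :: "'a set \<Rightarrow> 'a rel \<Rightarrow> 'a set \<Rightarrow> 'a set \<Rightarrow> bool" where
  "step_on V E B B' \<longleftrightarrow> (\<exists>u w. forces_on V E B u w \<and> B' = insert w B)"

definition forcing_set_on :: "'a set \<Rightarrow> 'a rel \<Rightarrow> 'a set \<Rightarrow> bool" where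
  "forcing_set_on V E B \<longleftrightarrow> B \<subseteq> V \<and> (step_on V E)\<^sup>*\<^sup>* B V"

definition tree_cover_on :: "'a set \<Rightarrow> 'a rel \<Rightarrow> 'a set set \<Rightarrow> bool" where
  "tree_cover_on V E P \<longleftrightarrow> partition_on V P \<and> (\<forall>X\<in>P. is_tree_on X E)"


text \<open>Turns equality of two minima into an exchange of witnesses that does not enlarge them.
  Existence of a witness need not be known: if one family is empty then so is the other, and both
  \<open>LEAST\<close> terms range over the empty predicate.\<close>

lemma Least_card_eqI:
  assumes "\<And>B. P B \<Longrightarrow> \<exists>B'. Q B' \<and> card B' \<le> card B"
    and "\<And>B. Q B \<Longrightarrow> \<exists>B'. P B' \<and> card B' \<le> card B"
  shows "(LEAST k. \<exists>B. P B \<and> card B = k) = (LEAST k. \<exists>B. Q B \<and> card B = k)"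
proof (cases "\<exists>B. P B")
  case True
  then obtain B where "P B" by blast
  then have exP: "\<exists>k. \<exists>B. P B \<and> card B = k" by blast
  from assms(1)[OF \<open>P B\<close>] have exQ: "\<exists>k. \<exists>B. Q B \<and> card B = k" by blast
  obtain B1 where B1: "P B1" "card B1 = (LEAST k. \<exists>B. P B \<and> card B = k)"
    using LeastI_ex[OF exP] by blast
  obtain B2 where B2: "Q B2" "card B2 = (LEAST k. \<exists>B. Q B \<and> card B = k)"
    using LeastI_ex[OF exQ] by blast
  obtain C1 where C1: "Q C1" "card C1 \<le> card B1" using assms(1)[OF B1(1)] by blast
  have "(LEAST k. \<exists>B. Q B \<and> card B = k) \<le> card C1"
    by (rule Least_le) (use C1 in blast)
  moreover obtain C2 where C2: "P C2" "card C2 \<le> card B2" using assms(2)[OF B2(1)] by blast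
  have "(LEAST k. \<exists>B. P B \<and> card B = k) \<le> card C2"
    by (rule Least_le) (use C2 in blast)
  ultimately show ?thesis using B1(2) B2(2) C1(2) C2(2) by linarith
next
  case False
  with assms(2) have "\<not> P B" "\<not> Q B'" for B B' by blast+
  then show ?thesis by simp
qed


section \<open>From digraphs to relations\<close>

lemma rtrancl_on_restrict:
  assumes "\<And>x y. x \<in> X \<Longrightarrow> y \<in> X \<Longrightarrow> (x, y) \<in> E \<longleftrightarrow> (x, y) \<in> E'"
  shows "rtrancl_on X E = rtrancl_on X E'"
proof -
  have "(x, y) \<in> rtrancl_on X F'" if "(x, y) \<in> rtrancl_on X F"
    "\<And>x y. x \<in> X \<Longrightarrow> y \<in> X \<Longrightarrow> (x, y) \<in> F \<Longrightarrow> (x, y) \<in> F'" for x y F F'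
    using that(1) by (induct rule: rtrancl_on_induct) (auto intro: rtrancl_on_into_rtrancl_on that(2))
  from this[of _ _ E E'] this[of _ _ E' E] show ?thesis using assms by auto
qed

lemma is_tree_on_restrict:
  assumes "\<And>x y. x \<in> X \<Longrightarrow> y \<in> X \<Longrightarrow> (x, y) \<in> E \<longleftrightarrow> (x, y) \<in> E'"
  shows "is_tree_on X E \<longleftrightarrow> is_tree_on X E'"
proof -
  have 1: "rtrancl_on X E = rtrancl_on X E'"
    by (rule rtrancl_on_restrict) (rule assms)
  have 2: "rtrancl_on (X - {a}) E = rtrancl_on (X - {a}) E'" for a
    by (rule rtrancl_on_restrict) (use assms in auto)
  \<comment> \<open>In the acyclicity clause \<open>x\<close> and \<open>y\<close> range over all
    vertices, but the walk between them puts them in \<open>X - {a}\<close>, where \<open>E\<close>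
    and \<open>E'\<close> agree.\<close>
  show ?thesis
    unfolding is_tree_on_def 1 2 using assms
    by (meson DiffD1 in_rtrancl_on_in_F)
qed

section \<open>Cycles and connectedness in terms of reachability\<close>

lemma (in pre_digraph) awalk_verts_snoc:
  assumes "cas x p (tail G e)"
  shows "awalk_verts x (p @ [e]) = awalk_verts x p @ [head G e]"
  using assms by (induct p arbitrary: x) auto

lemma (in wf_digraph) rtrancl_on_avoiding_if_awalk:
  assumes "awalk x p y" "a \<notin> set (awalk_verts x p)"
  shows "(x, y) \<in> rtrancl_on (verts G - {a}) (arcs_ends G)"
  using assms
proof (induct p arbitrary: x)
  case (Cons e p)
  then have walk: "(head G e, y) \<in> rtrancl_on (verts G - {a}) (arcs_ends G)"
    by (auto simp: awalk_Cons_iff)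
  have "(x, head G e) \<in> arcs_ends G" "x \<in> verts G - {a}"
    using Cons.prems in_arcs_imp_in_arcs_ends[of e] by (auto simp: awalk_Cons_iff)
  then show ?case using walk by (metis converse_rtrancl_on_into_rtrancl_on)
qed (auto simp: awalk_Nil_iff)

text \<open>Reachability avoiding \<open>a\<close> is reachability in the subgraph induced on the
  other vertices, where it yields a path. Since head and tail maps are shared, this is also a path
  of \<open>G\<close>.\<close>

lemma (in wf_digraph) apath_avoiding_if_rtrancl_on:
  assumes "(x, y) \<in> rtrancl_on (verts G - {a}) (arcs_ends G)"
  shows "\<exists>p. apath x p y \<and> a \<notin> set (awalk_verts x p)"
proof -
  let ?H = "G \<restriction> (verts G - {a})"
  interpret H: wf_digraph ?H ..
  have "rtrancl_on (verts G - {a}) (arcs_ends G) = rtrancl_on (verts G - {a}) (arcs_ends ?H)"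
    by (rule rtrancl_on_restrict) (auto simp: arcs_ends_conv)
  with assms have "x \<rightarrow>\<^sup>*\<^bsub>?H\<^esub> y" by (simp add: reachable_def)
  then obtain p where p: "H.apath x p y" unfolding H.reachable_apath ..
  have c: "compatible ?H G" by (rule compatible_induce_subgraph)
  from H.awalkI_apath[OF p] have verts: "set (H.awalk_verts x p) \<subseteq> verts G - {a}"
    by (elim H.awalkE) simp
  have "H.cas = cas" "H.awalk_verts = awalk_verts"
    using compatible_cas[OF c] compatible_awalk_verts[OF c] by auto
  moreover have "set p \<subseteq> arcs G" "x \<in> verts G"
    using H.awalkI_apath[OF p] by (auto simp only: H.awalk_def induce_subgraph_arcs induce_subgraph_verts)
  ultimately have "apath x p y" "a \<notin> set (awalk_verts x p)"
    using p verts by (auto simp only: H.apath_def apath_def H.awalk_def awalk_def)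
  then show ?thesis by blast
qed

text \<open>A cycle through \<open>a\<close> with at least three arcs is the same as two distinct
  neighbours of \<open>a\<close> with a path between them that avoids \<open>a\<close>: cut off the
  first and last arc, or add them.\<close>

lemma undirected_tree_iff:
  assumes "graph H"
  shows "undirected_tree H \<longleftrightarrow> is_tree_on (verts H) (arcs_ends H)"
proof -
  interpret H: graph H by fact
  \<comment> \<open>\<open>connected\<close> refers to the symmetric closure, which on a symmetric
    digraph gives the same reachability.\<close>
  have conn: "connected H \<longleftrightarrow> verts H \<noteq> {} \<and>
      (\<forall>x\<in>verts H. \<forall>y\<in>verts H. (x, y) \<in> rtrancl_on (verts H) (arcs_ends H))"
    unfolding connected_def strongly_connected_def
    by (simp add: H.reachable_mk_symmetric_eq[OF H.sym_arcs])
       (simp add: reachable_def)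
  have "\<exists>a\<in>verts H. \<exists>x y. (a, x) \<in> arcs_ends H \<and> (a, y) \<in> arcs_ends H \<and>
      (x, y) \<in> rtrancl_on (verts H - {a}) (arcs_ends H) \<and> x \<noteq> y"
    if p: "H.cycle p" "3 \<le> length p" for p
  proof -
    from p obtain u where u: "H.awalk u p u" "distinct (tl (H.awalk_verts u p))"
      by (auto simp: H.cycle_def)
    from p(2) obtain e p' where pe: "p = e # p'" "2 \<le> length p'"
      by (cases p) auto
    from pe(2) obtain q f where q: "p' = q @ [f]" "q \<noteq> []"
      by (cases p' rule: rev_cases) force+
    let ?x = "head H e" and ?y = "tail H f"
    from u(1) pe q have w: "e \<in> arcs H" "tail H e = u" "H.awalk ?x q ?y" "f \<in> arcs H" "head H f = u"
      by (auto simp: H.awalk_Cons_iff H.awalk_Nil_iff)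
    \<comment> \<open>The vertex list of the cycle without its head is that of \<open>q\<close>
      followed by \<open>u\<close>, so its distinctness says both that \<open>q\<close> is a path
      and that \<open>q\<close> avoids \<open>u\<close>.\<close>
    from u(2) pe q w have d: "distinct (H.awalk_verts ?x q @ [u])"
      by (simp add: H.awalk_verts_snoc H.awalk_def)
    then have "H.apath ?x q ?y" using w by (auto simp: H.apath_def)
    with q have "?x \<noteq> ?y" by (intro H.apath_nonempty_ends)
    moreover have "(?x, ?y) \<in> rtrancl_on (verts H - {u}) (arcs_ends H)"
      using w d by (intro H.rtrancl_on_avoiding_if_awalk) auto
    moreover have "(u, ?x) \<in> arcs_ends H" "(u, ?y) \<in> arcs_ends H"
      using w H.in_arcs_imp_in_arcs_ends[of e] H.in_arcs_imp_in_arcs_ends[of f]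
        H.graph_symmetric by auto
    moreover have "u \<in> verts H" using w by auto
    ultimately show ?thesis by blast
  qed
  moreover have "\<exists>p. H.cycle p \<and> 3 \<le> length p"
    if a: "(a, x) \<in> arcs_ends H" "(a, y) \<in> arcs_ends H"
      "(x, y) \<in> rtrancl_on (verts H - {a}) (arcs_ends H)" "x \<noteq> y" for a x y
  proof -
    from H.apath_avoiding_if_rtrancl_on[OF a(3)] obtain q where
      q: "H.apath x q y" "a \<notin> set (H.awalk_verts x q)" by blast
    obtain e where e: "e \<in> arcs H" "tail H e = a" "head H e = x" using a(1) by auto
    obtain f where f: "f \<in> arcs H" "tail H f = y" "head H f = a"
      using H.graph_symmetric[OF a(2)] by auto
    \<comment> \<open>The ends \<open>x\<close> and \<open>y\<close> differ, so \<open>q\<close> has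
      an arc and the closed walk reaches length three.\<close>
    have "q \<noteq> []" using q a(4) by (auto simp: H.apath_Nil_iff)
    moreover have "H.awalk a (e # q @ [f]) a"
      using q e f by (auto simp: H.awalk_Cons_iff H.awalk_Nil_iff H.apath_def)
    moreover have "distinct (tl (H.awalk_verts a (e # q @ [f])))"
    proof -
      have "tl (H.awalk_verts a (e # q @ [f])) = H.awalk_verts x q @ [a]"
        using q(1) e f by (simp add: H.awalk_verts_snoc H.apath_def H.awalk_def)
      then show ?thesis using q by (auto simp: H.apath_def)
    qed
    ultimately have "H.cycle (e # q @ [f])" "3 \<le> length (e # q @ [f])"
      by (auto simp: H.cycle_def Suc_le_eq)
    then show ?thesis by blast
  qed
  ultimately show ?thesis
    unfolding undirected_tree_def conn is_tree_on_def by blast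
qed

text \<open>Lets the arc relation of the whole graph stay fixed while \<open>X\<close> varies:
  \<open>is_tree_on\<close> depends only on the arcs inside \<open>X\<close>.\<close>

lemma undirected_tree_induce_iff:
  assumes "pair_graph G" "X \<subseteq> pverts G"
  shows "undirected_tree (with_proj G \<restriction> X) \<longleftrightarrow> is_tree_on X (parcs G)"
proof -
  interpret G: pair_graph G by fact
  have ind: "induced_subgraph (with_proj G \<restriction> X) (with_proj G)"
    using assms(2) by (intro G.induced_induce) simp
  have "graph (with_proj G \<restriction> X)"
    using G.induced_graph_imp_graph[OF ind] G.digraph_subgraph[OF induced_imp_subgraph[OF ind]]
    by (simp add: graph_def pseudo_graph_def digraph_def sym_digraph_def)
  then show ?thesis
    by (subst undirected_tree_iff, assumption, simp, intro is_tree_on_restrict)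
       (auto simp: arcs_ends_conv)
qed

lemma undirected_tree_pair_iff:
  assumes "pair_graph G"
  shows "undirected_tree (with_proj G) \<longleftrightarrow> is_tree_on (pverts G) (parcs G)"
  using undirected_tree_iff[OF pair_graph.pair_graphD_graph[OF assms]] by simp

section \<open>The forcing rule and tree covers as relations\<close>

lemma psd_forces_iff:
  assumes "pair_graph G" "B \<subseteq> pverts G"
  shows "psd_forces (with_proj G) B u w \<longleftrightarrow> forces_on (pverts G) (parcs G) B u w"
proof -
  interpret G: pair_graph G by fact
  let ?V = "pverts G" and ?E = "parcs G"
  let ?H = "with_proj G \<restriction> (?V - B)"
  have symE: "sym ?E" using G.arcs_symmetric by (auto intro: symI)
  have symR: "(x, y) \<in> rtrancl_on S ?E \<longleftrightarrow> (y, x) \<in> rtrancl_on S ?E" for x y S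
    using rtrancl_on_sym[OF symE] by (auto dest: symD)
  have reach: "x \<rightarrow>\<^sup>*\<^bsub>?H\<^esub> y \<longleftrightarrow> (x, y) \<in> rtrancl_on (?V - B) ?E" for x y
    unfolding reachable_def
    by (simp, subst rtrancl_on_restrict[where E' = ?E]) (auto simp: arcs_ends_conv)
  let ?W = "\<lambda>w. {x. (w, x) \<in> rtrancl_on (?V - B) ?E}"
  \<comment> \<open>By symmetry reachability is an equivalence on the white vertices, so the
    component containing \<open>w\<close> is its class; this removes the existential over components
    from the rule.\<close>
  have sccs: "W \<in> pre_digraph.sccs_verts ?H \<and> w \<in> W \<longleftrightarrow> W = ?W w \<and> w \<in> ?V - B" for W
  proof
    assume "W \<in> pre_digraph.sccs_verts ?H \<and> w \<in> W"
    then have W: "w \<in> W" "\<And>x y. x \<in> W \<Longrightarrow> y \<in> W \<Longrightarrow> (x, y) \<in> rtrancl_on (?V - B) ?E"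
      "\<And>x y. x \<in> W \<Longrightarrow> y \<notin> W \<Longrightarrow> (x, y) \<notin> rtrancl_on (?V - B) ?E \<or> (y, x) \<notin> rtrancl_on (?V - B) ?E"
      unfolding pre_digraph.sccs_verts_def reach by blast+
    have "x \<in> W" if "(w, x) \<in> rtrancl_on (?V - B) ?E" for x
      using W(3)[OF W(1), of x] that symR[of w x] by blast
    then have "W = ?W w" using W(2)[OF W(1)] by blast
    then show "W = ?W w \<and> w \<in> ?V - B"
      using in_rtrancl_on_in_F(1)[OF W(2)[OF W(1,1)]] by blast
  next
    assume W: "W = ?W w \<and> w \<in> ?V - B"
    then have w: "w \<in> W" by auto
    have "(x, y) \<in> rtrancl_on (?V - B) ?E" if "x \<in> W" "y \<in> W" for x y
      using that W symR[of x w] rtrancl_on_trans[of x w "?V - B" ?E y] by auto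
    moreover have "(x, y) \<notin> rtrancl_on (?V - B) ?E" if "x \<in> W" "y \<notin> W" for x y
      using that W rtrancl_on_trans[of w x "?V - B" ?E y] by auto
    ultimately have "W \<in> pre_digraph.sccs_verts ?H"
      unfolding pre_digraph.sccs_verts_def reach using w by fast
    then show "W \<in> pre_digraph.sccs_verts ?H \<and> w \<in> W" using w ..
  qed
  \<comment> \<open>A vertex of \<open>B \<union> ?W w\<close> is white exactly when it lies in
    \<open>?W w\<close>, as components of white vertices are disjoint from \<open>B\<close>.\<close>
  have dom: "{x. x \<notin> B \<and> u \<rightarrow>\<^bsub>with_proj G \<restriction> (B \<union> ?W w)\<^esub> x} = {x \<in> ?W w. (u, x) \<in> ?E}" if "u \<in> B"
    using that by (auto simp: arcs_ends_conv dest: in_rtrancl_on_in_F)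
  have "psd_forces (with_proj G) B u w \<longleftrightarrow> u \<in> B \<and> w \<in> ?V - B \<and>
      {x. x \<notin> B \<and> u \<rightarrow>\<^bsub>with_proj G \<restriction> (B \<union> ?W w)\<^esub> x} = {w}"
  proof -
    have "psd_forces (with_proj G) B u w \<longleftrightarrow> u \<in> B \<and> (\<exists>W. (W \<in> pre_digraph.sccs_verts ?H \<and> w \<in> W) \<and>
        {x. x \<notin> B \<and> u \<rightarrow>\<^bsub>with_proj G \<restriction> (B \<union> W)\<^esub> x} = {w})"
      unfolding psd_forces_def Bex_def by (simp only: with_proj_simps conj_assoc)
    then show ?thesis unfolding sccs by simp
  qed
  also have "\<dots> \<longleftrightarrow> u \<in> B \<and> w \<in> ?V - B \<and> {x \<in> ?W w. (u, x) \<in> ?E} = {w}"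
    by (intro conj_cong refl) (simp only: dom)
  also have "\<dots> \<longleftrightarrow> forces_on ?V ?E B u w"
  proof -
    have "{x \<in> ?W w. (u, x) \<in> ?E} = {w} \<longleftrightarrow>
        (u, w) \<in> ?E \<and> (\<forall>x. (u, x) \<in> ?E \<longrightarrow> (w, x) \<in> rtrancl_on (?V - B) ?E \<longrightarrow> x = w)"
      if "w \<in> ?V - B"
      using rtrancl_on_refl[OF that, of ?E] by blast
    then show ?thesis unfolding forces_on_def by blast
  qed
  finally show ?thesis .
qed

lemma step_on_subset: "step_on V E B B' \<Longrightarrow> B \<subseteq> V \<Longrightarrow> B' \<subseteq> V"
  by (auto simp: step_on_def forces_on_def)

lemma positive_zero_forcing_set_iff:
  assumes "pair_graph G"
  shows "positive_zero_forcing_set (with_proj G) B \<longleftrightarrow> forcing_set_on (pverts G) (parcs G) B"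
proof -
  let ?V = "pverts G" and ?E = "parcs G"
  have step_iff: "psd_step (with_proj G) B B' \<longleftrightarrow> step_on ?V ?E B B'" if "B \<subseteq> ?V" for B B'
    using psd_forces_iff[OF assms that] by (simp add: psd_step_def step_on_def)
  have "(psd_step (with_proj G))\<^sup>*\<^sup>* B C \<longleftrightarrow> (step_on ?V ?E)\<^sup>*\<^sup>* B C" if B: "B \<subseteq> ?V" for C
  proof
    assume "(psd_step (with_proj G))\<^sup>*\<^sup>* B C"
    \<comment> \<open>The comparison of single steps assumes a black set of vertices of the graph,
      so containment is carried along the run.\<close>
    then have "(step_on ?V ?E)\<^sup>*\<^sup>* B C \<and> C \<subseteq> ?V"
    proof induct
      case (step S S')
      then show ?case using step_iff step_on_subset by (meson rtranclp.rtrancl_into_rtrancl)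
    qed (use B in auto)
    then show "(step_on ?V ?E)\<^sup>*\<^sup>* B C" ..
  next
    assume "(step_on ?V ?E)\<^sup>*\<^sup>* B C"
    then have "(psd_step (with_proj G))\<^sup>*\<^sup>* B C \<and> C \<subseteq> ?V"
    proof induct
      case (step S S')
      then show ?case using step_iff step_on_subset by (meson rtranclp.rtrancl_into_rtrancl)
    qed (use B in auto)
    then show "(psd_step (with_proj G))\<^sup>*\<^sup>* B C" ..
  qed
  then show ?thesis
    by (auto simp: positive_zero_forcing_set_def forcing_set_on_def)
qed

lemma induced_tree_cover_iff:
  assumes "pair_graph G"
  shows "induced_tree_cover (with_proj G) P \<longleftrightarrow> tree_cover_on (pverts G) (parcs G) P"
proof -
  have "X \<subseteq> pverts G" if "partition_on (pverts G) P" "X \<in> P" for X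
    using that partition_onD1 by blast
  then show ?thesis
    unfolding induced_tree_cover_def tree_cover_on_def with_proj_simps
    using undirected_tree_induce_iff[OF assms] by blast
qed


section \<open>Transfer along embeddings\<close>

text \<open>Applied to \<open>Inl\<close> and to \<open>glue v w\<close>, both with the edges of the
  vertex-sum as \<open>E'\<close>. Edges are compared only between images of vertices in
  \<open>V\<close>, so \<open>E'\<close> may also contain the edges of the other summand.\<close>

locale embedding =
  fixes f :: "'a \<Rightarrow> 'b" and V :: "'a set" and E :: "'a rel" and E' :: "'b rel"
  assumes inj: "inj f"
    and edge_iff: "\<And>x y. x \<in> V \<Longrightarrow> y \<in> V \<Longrightarrow> (f x, f y) \<in> E' \<longleftrightarrow> (x, y) \<in> E"
begin

lemma rtrancl_on_image_iff:
  assumes "X \<subseteq> V"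
  shows "(f x, f y) \<in> rtrancl_on (f ` X) E' \<longleftrightarrow> (x, y) \<in> rtrancl_on X E"
proof
  \<comment> \<open>The endpoint is generalised to an arbitrary \<open>b\<close> for the induction,
    which finds its preimage along with the lifted walk.\<close>
  have "\<exists>y. b = f y \<and> (x, y) \<in> rtrancl_on X E" if "(f x, b) \<in> rtrancl_on (f ` X) E'" for b
    using that
  proof (induct rule: rtrancl_on_induct)
    case base
    then have "x \<in> X" by (simp add: inj_image_mem_iff[OF inj])
    then show ?case by auto
  next
    case (step b c)
    then obtain y z where yz: "b = f y" "(x, y) \<in> rtrancl_on X E" "c = f z" "z \<in> X" by auto
    moreover have "y \<in> X" using yz(2) by (rule in_rtrancl_on_in_F)
    ultimately have "(y, z) \<in> E" using step(2) edge_iff assms by blast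
    with yz show ?case by (auto intro: rtrancl_on_into_rtrancl_on)
  qed
  moreover assume "(f x, f y) \<in> rtrancl_on (f ` X) E'"
  ultimately obtain z where "f y = f z" "(x, z) \<in> rtrancl_on X E" by blast
  then show "(x, y) \<in> rtrancl_on X E" by (simp add: inj_eq[OF inj])
next
  assume "(x, y) \<in> rtrancl_on X E"
  then show "(f x, f y) \<in> rtrancl_on (f ` X) E'"
  proof (induct rule: rtrancl_on_induct)
    case (step y z)
    then have "(f y, f z) \<in> E'" using assms edge_iff[of y z] by blast
    with step show ?case by (auto intro: rtrancl_on_into_rtrancl_on)
  qed auto
qed

lemma is_tree_on_image_iff:
  assumes "X \<subseteq> V"
  shows "is_tree_on (f ` X) E' \<longleftrightarrow> is_tree_on X E"
proof -
  have diff: "f ` X - {f a} = f ` (X - {a})" for a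
    by (auto simp: inj_eq[OF inj])
  have "(\<forall>x y. (f a, x) \<in> E' \<longrightarrow> (f a, y) \<in> E' \<longrightarrow> (x, y) \<in> rtrancl_on (f ` X - {f a}) E' \<longrightarrow> x = y)
    \<longleftrightarrow> (\<forall>x y. (a, x) \<in> E \<longrightarrow> (a, y) \<in> E \<longrightarrow> (x, y) \<in> rtrancl_on (X - {a}) E \<longrightarrow> x = y)"
    (is "?L \<longleftrightarrow> ?R") if a: "a \<in> X" for a
  proof
    assume L: ?L
    show ?R
    proof (intro allI impI)
      fix x y assume xy: "(a, x) \<in> E" "(a, y) \<in> E" "(x, y) \<in> rtrancl_on (X - {a}) E"
      then have "x \<in> X" "y \<in> X" by (auto dest: in_rtrancl_on_in_F)
      then have "(f a, f x) \<in> E'" "(f a, f y) \<in> E'" using xy a assms edge_iff by auto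
      moreover have "(f x, f y) \<in> rtrancl_on (f ` X - {f a}) E'"
        unfolding diff by (subst rtrancl_on_image_iff) (use assms xy in auto)
      ultimately have "f x = f y" using L by blast
      then show "x = y" using inj by (simp add: inj_eq)
    qed
  next
    assume R: ?R
    show ?L
    proof (intro allI impI)
      fix x' y' assume xy: "(f a, x') \<in> E'" "(f a, y') \<in> E'"
        "(x', y') \<in> rtrancl_on (f ` X - {f a}) E'"
      \<comment> \<open>The neighbours of \<open>f a\<close> have preimages because the walk joining
        them stays in the image.\<close>
      then obtain x y where f: "x' = f x" "y' = f y" "x \<in> X" "y \<in> X"
        by (meson DiffD1 imageE in_rtrancl_on_in_F)
      have "(x, y) \<in> rtrancl_on (X - {a}) E"
        by (subst rtrancl_on_image_iff[symmetric]) (use assms xy diff f in auto)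
      moreover have "(a, x) \<in> E" "(a, y) \<in> E" using edge_iff f a assms xy by auto
      ultimately show "x' = y'" using R f by blast
    qed
  qed
  then show ?thesis
    unfolding is_tree_on_def by (simp add: rtrancl_on_image_iff[OF assms])
qed

lemma forces_on_image_iff:
  assumes "B \<subseteq> V" "u \<in> V" "w \<in> V"
  shows "forces_on (f ` V) E' (f ` B) (f u) (f w) \<longleftrightarrow> forces_on V E B u w"
proof -
  have diff: "f ` V - f ` B = f ` (V - B)"
    by (rule image_set_diff[OF inj, symmetric])
  have "(\<forall>x. (f u, x) \<in> E' \<longrightarrow> (f w, x) \<in> rtrancl_on (f ` (V - B)) E' \<longrightarrow> x = f w) \<longleftrightarrow>
    (\<forall>x. (u, x) \<in> E \<longrightarrow> (w, x) \<in> rtrancl_on (V - B) E \<longrightarrow> x = w)" (is "?L \<longleftrightarrow> ?R")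
  proof
    assume L: ?L
    show ?R
    proof (intro allI impI)
      fix x assume x: "(u, x) \<in> E" "(w, x) \<in> rtrancl_on (V - B) E"
      then have "x \<in> V" by (auto dest: in_rtrancl_on_in_F)
      then have "f x = f w" using L x rtrancl_on_image_iff[of "V - B" w x] assms edge_iff by auto
      then show "x = w" using inj by (simp add: inj_eq)
    qed
  next
    assume R: ?R
    show ?L
    proof (intro allI impI)
      fix x' assume x: "(f u, x') \<in> E'" "(f w, x') \<in> rtrancl_on (f ` (V - B)) E'"
      then obtain x where "x' = f x" "x \<in> V" by (auto dest!: in_rtrancl_on_in_F)
      then show "x' = f w" using R x rtrancl_on_image_iff[of "V - B" w x] assms edge_iff by auto
    qed
  qed
  then show ?thesis
    unfolding forces_on_def diff using assms edge_iff
    by (auto simp: inj_image_mem_iff[OF inj])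
qed

lemma step_on_image:
  assumes "step_on V E B B'" "B \<subseteq> V"
  shows "step_on (f ` V) E' (f ` B) (f ` B')"
proof -
  from assms(1) obtain u w where uw: "forces_on V E B u w" "B' = insert w B"
    by (auto simp: step_on_def)
  moreover have "u \<in> V" "w \<in> V" using uw(1) assms(2) by (auto simp: forces_on_def)
  ultimately show ?thesis
    unfolding step_on_def using forces_on_image_iff[OF assms(2)] by blast
qed

lemma step_on_image_cases:
  assumes "step_on (f ` V) E' (f ` B) C" "B \<subseteq> V"
  obtains B' where "C = f ` B'" "step_on V E B B'"
proof -
  from assms(1) obtain u w where uw: "forces_on (f ` V) E' (f ` B) u w" "C = insert w (f ` B)"
    by (auto simp: step_on_def)
  then obtain u' w' where "u = f u'" "w = f w'" "u' \<in> V" "w' \<in> V"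
    using assms(2) by (auto simp: forces_on_def)
  with uw show ?thesis
    using forces_on_image_iff[OF assms(2)]
    by (intro that[of "insert w' B"]) (auto simp: step_on_def)
qed

lemma forcing_set_on_image_iff:
  assumes "B \<subseteq> V"
  shows "forcing_set_on (f ` V) E' (f ` B) \<longleftrightarrow> forcing_set_on V E B"
proof
  assume "forcing_set_on V E B"
  then have reach: "(step_on V E)\<^sup>*\<^sup>* B V" by (simp add: forcing_set_on_def)
  have "(step_on (f ` V) E')\<^sup>*\<^sup>* (f ` B) (f ` C) \<and> C \<subseteq> V" if "(step_on V E)\<^sup>*\<^sup>* B C" for C
    using that
  proof induct
    case (step B' B'')
    then show ?case using step_on_image step_on_subset
      by (meson rtranclp.rtrancl_into_rtrancl)
  qed (use assms in auto)
  from this[OF reach] show "forcing_set_on (f ` V) E' (f ` B)"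
    using assms by (auto simp: forcing_set_on_def)
next
  assume "forcing_set_on (f ` V) E' (f ` B)"
  then have "(step_on (f ` V) E')\<^sup>*\<^sup>* (f ` B) (f ` V)" by (simp add: forcing_set_on_def)
  then have "\<exists>C. f ` V = f ` C \<and> (step_on V E)\<^sup>*\<^sup>* B C \<and> C \<subseteq> V"
  proof induct
    case (step B' B'')
    then obtain C where C: "B' = f ` C" "(step_on V E)\<^sup>*\<^sup>* B C" "C \<subseteq> V" by blast
    from step(2) C obtain C' where "B'' = f ` C'" "step_on V E C C'"
      by (metis step_on_image_cases)
    then show ?case using C step_on_subset[of V E C C']
      by (intro exI[of _ C']) (auto intro: rtranclp.rtrancl_into_rtrancl)
  qed (use assms in auto)
  then show "forcing_set_on V E B"
    using assms by (auto simp: forcing_set_on_def inj_image_eq_iff[OF inj])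
qed

lemma tree_cover_on_image_iff:
  assumes "\<Union>P \<subseteq> V"
  shows "tree_cover_on (f ` V) E' ((`) f ` P) \<longleftrightarrow> tree_cover_on V E P"
proof -
  have "partition_on (f ` V) ((`) f ` P) \<longleftrightarrow> partition_on V P"
    unfolding partition_on_def disjoint_def
    by (auto simp: image_Union[symmetric] inj_image_eq_iff[OF inj] image_Int[OF inj, symmetric]
        simp flip: image_Union)
  moreover have "is_tree_on (f ` X) E' \<longleftrightarrow> is_tree_on X E" if "X \<in> P" for X
    using that assms by (intro is_tree_on_image_iff) auto
  ultimately show ?thesis by (auto simp: tree_cover_on_def)
qed

lemma Least_forcing_set_image:
  "(LEAST k. \<exists>B. forcing_set_on (f ` V) E' B \<and> card B = k) =
   (LEAST k. \<exists>B. forcing_set_on V E B \<and> card B = k)"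
proof -
  have card: "card (f ` B) = card B" for B
    by (rule card_image) (rule inj_on_subset[OF inj subset_UNIV])
  show ?thesis
  proof (rule Least_card_eqI)
    fix B' assume B': "forcing_set_on (f ` V) E' B'"
    then have "B' \<subseteq> f ` V" by (simp add: forcing_set_on_def)
    then obtain B where B: "B' = f ` B" "B \<subseteq> V" by (meson subset_imageE)
    with B' have "forcing_set_on V E B" by (simp add: forcing_set_on_image_iff)
    then show "\<exists>B. forcing_set_on V E B \<and> card B \<le> card B'"
      unfolding B card by blast
  next
    fix B assume B: "forcing_set_on V E B"
    then have "B \<subseteq> V" by (simp add: forcing_set_on_def)
    with B have "forcing_set_on (f ` V) E' (f ` B)" by (simp add: forcing_set_on_image_iff)
    then show "\<exists>B'. forcing_set_on (f ` V) E' B' \<and> card B' \<le> card B"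
      by (intro exI[of _ "f ` B"]) (simp add: card)
  qed
qed

lemma Least_tree_cover_image:
  "(LEAST k. \<exists>P. tree_cover_on (f ` V) E' P \<and> card P = k) =
   (LEAST k. \<exists>P. tree_cover_on V E P \<and> card P = k)"
proof -
  have inj2: "inj ((`) f)" using inj_image_eq_iff[OF inj] by (intro injI) blast
  have card: "card ((`) f ` P) = card P" for P
    by (rule card_image) (rule inj_on_subset[OF inj2 subset_UNIV])
  show ?thesis
  proof (rule Least_card_eqI)
    fix P' assume P': "tree_cover_on (f ` V) E' P'"
    then have "P' \<subseteq> Pow (f ` V)" by (auto simp: tree_cover_on_def partition_on_def)
    \<comment> \<open>Each member of the cover is the image of a subset of \<open>V\<close>, so the
      whole cover can be pulled back.\<close>
    then have "P' \<subseteq> (`) f ` Pow V" by (simp add: image_Pow_surj)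
    then obtain P where "P' = (`) f ` P" "P \<subseteq> Pow V" by (meson subset_imageE)
    with P' show "\<exists>P. tree_cover_on V E P \<and> card P \<le> card P'"
      using tree_cover_on_image_iff[of P] card by auto
  next
    fix P assume "tree_cover_on V E P"
    then have "tree_cover_on (f ` V) E' ((`) f ` P)"
      by (subst tree_cover_on_image_iff) (auto simp: tree_cover_on_def partition_on_def)
    then show "\<exists>P'. tree_cover_on (f ` V) E' P' \<and> card P' \<le> card P"
      by (intro exI[of _ "(`) f ` P"]) (simp add: card)
  qed
qed

end


section \<open>Gluing at a vertex\<close>

text \<open>The conditions are symmetric in \<open>A\<close> and \<open>C\<close>, so facts proved
  for \<open>A\<close> hold for \<open>C\<close> through \<open>swap\<close>. Crossing between the
  two sides is possible only at \<open>v\<close>.\<close>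

locale gluing =
  fixes A C :: "'a set" and v :: 'a and E :: "'a rel"
  assumes edges: "E \<subseteq> A \<times> A \<union> C \<times> C"
    and inter: "A \<inter> C = {v}"
begin

lemma swap: "gluing C A v E"
  using edges inter by unfold_locales auto

lemma edge_leaving:
  assumes "(x, y) \<in> E" "x \<in> A" "y \<notin> A"
  shows "x = v"
proof -
  have "x \<in> A \<inter> C" using assms edges by auto
  then show ?thesis unfolding inter by simp
qed

lemma edge_entering:
  assumes "(x, y) \<in> E" "x \<notin> A" "y \<in> A"
  shows "y = v"
proof -
  have "y \<in> A \<inter> C" using assms edges by auto
  then show ?thesis unfolding inter by simp
qed

text \<open>The \<open>else\<close> branch is the induction invariant for excursions: once the walk
  leaves \<open>A\<close>, its retraction waits at \<open>v\<close>, and the walk can return only at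
  \<open>v\<close>.\<close>

lemma rtrancl_on_retract:
  assumes "(x, y) \<in> rtrancl_on S E" "x \<in> A"
  shows "if y \<in> A then (x, y) \<in> rtrancl_on (S \<inter> A) E
    else v \<in> S \<and> (x, v) \<in> rtrancl_on (S \<inter> A) E"
  using assms
proof (induct rule: rtrancl_on_induct)
  case (step y z)
  show ?case
  proof (cases "y \<in> A")
    case y: True
    show ?thesis
    proof (cases "z \<in> A")
      case True
      with y step show ?thesis by (auto intro: rtrancl_on_into_rtrancl_on)
    next
      case False
      with y step(2) have "y = v" by (intro edge_leaving)
      with False y step show ?thesis by auto
    qed
  next
    case y: False
    then have "z \<in> A \<Longrightarrow> z = v" using step(2) by (intro edge_entering)
    with y step show ?thesis by auto
  qed
qed auto

lemma rtrancl_on_retract_in: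
  assumes "(x, y) \<in> rtrancl_on S E" "x \<in> A" "y \<in> A"
  shows "(x, y) \<in> rtrancl_on (S \<inter> A) E"
  using rtrancl_on_retract[OF assms(1,2)] assms(3) by simp

lemma rtrancl_on_retract_out:
  assumes "(x, y) \<in> rtrancl_on S E" "x \<in> A" "y \<notin> A"
  shows "v \<in> S"
  using rtrancl_on_retract[OF assms(1,2)] assms(3) by simp

section \<open>Intersecting and gluing trees\<close>

lemma is_tree_on_Int:
  assumes X: "is_tree_on X E" and ne: "X \<inter> A \<noteq> {}"
  shows "is_tree_on (X \<inter> A) E"
  unfolding is_tree_on_def
proof (intro conjI ballI allI impI ne)
  fix x y assume "x \<in> X \<inter> A" "y \<in> X \<inter> A"
  then show "(x, y) \<in> rtrancl_on (X \<inter> A) E"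
    using X by (intro rtrancl_on_retract_in) (auto simp: is_tree_on_def)
next
  fix a x y assume a: "a \<in> X \<inter> A" "(a, x) \<in> E" "(a, y) \<in> E" "(x, y) \<in> rtrancl_on (X \<inter> A - {a}) E"
  from a(4) have "(x, y) \<in> rtrancl_on (X - {a}) E"
    by (rule rtrancl_on_mono[rotated 2]) auto
  then show "x = y" using X a unfolding is_tree_on_def by blast
qed

text \<open>All vertices are connected through \<open>v\<close>. If two neighbours of
  \<open>a\<close> lie on the same side, the walk between them retracts to that side, which is a
  tree; if they lie on different sides, then \<open>a = v\<close> and no walk between them avoids
  \<open>a\<close>.\<close>

lemma is_tree_on_Un:
  assumes X: "is_tree_on X E" "X \<subseteq> A" "v \<in> X" and Y: "is_tree_on Y E" "Y \<subseteq> C" "v \<in> Y"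
  shows "is_tree_on (X \<union> Y) E"
proof -
  interpret sw: gluing C A v E by (rule swap)
  have to: "(x, v) \<in> rtrancl_on (X \<union> Y) E \<and> (v, x) \<in> rtrancl_on (X \<union> Y) E" if "x \<in> X \<union> Y" for x
    using that X Y unfolding is_tree_on_def
    by (blast intro: rtrancl_on_mono[OF subset_refl, of X "X \<union> Y"]
        rtrancl_on_mono[OF subset_refl, of Y "X \<union> Y"])
  have unique: "x = y" if a: "a \<in> X \<union> Y" "(a, x) \<in> E" "(a, y) \<in> E"
    "(x, y) \<in> rtrancl_on (X \<union> Y - {a}) E" for a x y
  proof -
    have eqA: "(X \<union> Y - {a}) \<inter> A = X - {a}" using X Y inter by auto
    have eqC: "(X \<union> Y - {a}) \<inter> C = Y - {a}" using X Y inter by auto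
    have "x \<in> A \<union> C" "y \<in> A \<union> C" using a edges by auto
    then consider "x \<in> A" "y \<in> A" | "x \<in> C" "y \<in> C" | "x \<in> A" "x \<notin> C" "y \<in> C" "y \<notin> A"
      | "x \<in> C" "x \<notin> A" "y \<in> A" "y \<notin> C" by blast
    then show ?thesis
    proof cases
      case 1
      show ?thesis
      proof (cases "a \<in> A")
        case True
        then have "a \<in> X" using a Y inter X by auto
        then show ?thesis
          using rtrancl_on_retract_in[OF a(4) 1] a X(1) unfolding eqA is_tree_on_def by blast
      next
        case False
        \<comment> \<open>Here \<open>a\<close> lies outside \<open>A\<close>, so both neighbours
          are \<open>v\<close>.\<close>
        then show ?thesis using 1 a(2,3) by (metis edge_entering)
      qed
    next
      case 2
      show ?thesis
      proof (cases "a \<in> C")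
        case True
        then have "a \<in> Y" using a Y inter X by auto
        then show ?thesis
          using sw.rtrancl_on_retract_in[OF a(4) 2] a Y(1) unfolding eqC is_tree_on_def by blast
      next
        case False
        then show ?thesis using 2 a(2,3) by (metis sw.edge_entering)
      qed
    next
      case 3
      then have "a \<in> A" using a(2) edges by auto
      \<comment> \<open>The edge to \<open>x\<close> puts \<open>a\<close> in \<open>A\<close> and
        the edge to \<open>y\<close> leaves \<open>A\<close>. The walk from \<open>x\<close> to
        \<open>y\<close> must then visit \<open>v\<close>, which has been removed.\<close>
      then have "a = v" using a(3) 3 by (intro edge_leaving)
      then show ?thesis using rtrancl_on_retract_out[OF a(4)] 3 by auto
    next
      case 4
      then have "a \<in> C" using a(2) edges by auto
      then have "a = v" using a(3) 4 by (intro sw.edge_leaving)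
      then show ?thesis using sw.rtrancl_on_retract_out[OF a(4)] 4 by auto
    qed
  qed
  show ?thesis
    unfolding is_tree_on_def using to unique X(3) by (blast intro: rtrancl_on_trans)
qed

section \<open>Tree covers of the glued graph\<close>

lemma tree_cover_on_restrict:
  assumes "tree_cover_on (A \<union> C) E P" "finite (A \<union> C)"
  shows "\<exists>P'. tree_cover_on A E P' \<and> card P' \<le> card P"
proof (intro exI conjI)
  \<comment> \<open>Trees contained in \<open>C - A\<close> leave the empty trace, which a partition
    excludes.\<close>
  let ?P = "(\<lambda>X. X \<inter> A) ` P - {{}}"
  have P: "partition_on (A \<union> C) P" "\<And>X. X \<in> P \<Longrightarrow> is_tree_on X E"
    using assms(1) by (auto simp: tree_cover_on_def)
  have "finite P" using finite_elements[OF assms(2) P(1)] .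
  have "card ?P \<le> card ((\<lambda>X. X \<inter> A) ` P)"
    using \<open>finite P\<close> by (intro card_mono) auto
  also have "\<dots> \<le> card P" using \<open>finite P\<close> by (rule card_image_le)
  finally show "card ?P \<le> card P" .
  have "partition_on A ?P"
  proof (rule partition_onI)
    show "\<Union>?P = A" using partition_onD1[OF P(1)] by blast
    show "disjnt p q" if "p \<in> ?P" "q \<in> ?P" "p \<noteq> q" for p q
      using that disjointD[OF partition_onD2[OF P(1)]] by (fastforce simp: disjnt_def)
  qed auto
  then show "tree_cover_on A E ?P"
    unfolding tree_cover_on_def using P(2) is_tree_on_Int by blast
qed

lemma tree_cover_on_extend:
  assumes "tree_cover_on A E P" "is_tree_on C E" "finite A"
  shows "\<exists>P'. tree_cover_on (A \<union> C) E P' \<and> card P' \<le> card P"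
proof -
  have P: "partition_on A P" "\<And>X. X \<in> P \<Longrightarrow> is_tree_on X E"
    using assms(1) by (auto simp: tree_cover_on_def)
  have fin: "finite P" using finite_elements[OF assms(3) P(1)] .
  have "v \<in> A" "v \<in> C" using inter by auto
  then obtain X where X: "X \<in> P" "v \<in> X" using partition_onD1[OF P(1)] by auto
  have sub: "Y \<subseteq> A" if "Y \<in> P" for Y using that partition_onD1[OF P(1)] by auto
  \<comment> \<open>A member of \<open>P\<close> can meet \<open>C\<close> only in \<open>v\<close>,
    and \<open>v\<close> belongs to \<open>X\<close>; hence enlarging \<open>X\<close> by
    \<open>C\<close> keeps the members disjoint.\<close>
  have other: "Y \<inter> (X \<union> C) = {}" if "Y \<in> P" "Y \<noteq> X" for Y
  proof -
    have "Y \<inter> X = {}" using that X(1) disjointD[OF partition_onD2[OF P(1)]] by blast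
    moreover have "Y \<inter> C \<subseteq> {v}" using sub[OF that(1)] unfolding inter[symmetric] by blast
    ultimately show ?thesis using X(2) by blast
  qed
  let ?P = "insert (X \<union> C) (P - {X})"
  have "partition_on (A \<union> C) ?P"
  proof (rule partition_onI)
    show "\<Union>?P = A \<union> C" using partition_onD1[OF P(1)] X by auto
    show "disjnt p q" if "p \<in> ?P" "q \<in> ?P" "p \<noteq> q" for p q
      using that other disjointD[OF partition_onD2[OF P(1)], of p q] unfolding disjnt_def by blast
    show "{} \<notin> ?P" using X partition_onD3[OF P(1)] by auto
  qed
  moreover have "is_tree_on (X \<union> C) E"
    using X P(2) sub assms(2) \<open>v \<in> C\<close> by (intro is_tree_on_Un) auto
  ultimately have "tree_cover_on (A \<union> C) E ?P"
    unfolding tree_cover_on_def using P(2) by blast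
  moreover have "card ?P \<le> card P"
    using fin card_Suc_Diff1[OF fin X(1)] by (simp add: card_insert_if)
  ultimately show ?thesis by blast
qed

section \<open>Zero forcing in the glued graph\<close>

lemma forcing_set_on_restrict:
  assumes B: "forcing_set_on (A \<union> C) E B" and fin: "finite (A \<union> C)"
  shows "\<exists>B'. forcing_set_on A E B' \<and> card B' \<le> card B"
proof (intro exI conjI)
  \<comment> \<open>Simulation invariant: a black set of the sum is dominated in \<open>A\<close>, with \<open>v\<close> black as soon as
    any vertex of \<open>C - A\<close> is.\<close>
  let ?B = "B \<inter> A \<union> (if B \<inter> (C - A) = {} then {} else {v})"
  have sub: "B \<subseteq> A \<union> C" and reach: "(step_on (A \<union> C) E)\<^sup>*\<^sup>* B (A \<union> C)"
    using B by (auto simp: forcing_set_on_def)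
  have finB: "finite B" using sub fin by (rule finite_subset)
  \<comment> \<open>The added vertex \<open>v\<close> is paid for by a vertex of \<open>B\<close> in
    \<open>C - A\<close>.\<close>
  have "card ?B \<le> card (B \<inter> A) + card (B \<inter> (C - A))"
  proof (cases "B \<inter> (C - A) = {}")
    case False
    then have "card (B \<inter> (C - A)) \<noteq> 0" using finB by simp
    moreover have "card (B \<inter> A \<union> {v}) \<le> card (B \<inter> A) + 1"
      by (rule order_trans[OF card_Un_le]) simp
    ultimately show ?thesis using False by simp
  qed simp
  also have "\<dots> = card (B \<inter> A \<union> B \<inter> (C - A))"
    using finB by (intro card_Un_disjoint[symmetric]) auto
  also have "\<dots> \<le> card B" using finB by (intro card_mono) auto
  finally show "card ?B \<le> card B" .
  have vA: "v \<in> A" using inter by auto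
  have "\<exists>S'. (step_on A E)\<^sup>*\<^sup>* ?B S' \<and> S' \<subseteq> A \<and> S \<inter> A \<subseteq> S' \<and> (S \<inter> (C - A) \<noteq> {} \<longrightarrow> v \<in> S')"
    if "(step_on (A \<union> C) E)\<^sup>*\<^sup>* B S" for S
    using that
  proof induct
    case base
    show ?case by (rule exI[of _ ?B]) (use vA in auto)
  next
    case (step S T)
    then obtain S' where S': "(step_on A E)\<^sup>*\<^sup>* ?B S'" "S' \<subseteq> A" "S \<inter> A \<subseteq> S'"
      "S \<inter> (C - A) \<noteq> {} \<Longrightarrow> v \<in> S'" by blast
    from step(2) obtain y x where f: "y \<in> S" "x \<in> A \<union> C - S" "(y, x) \<in> E"
      "\<And>z. (y, z) \<in> E \<Longrightarrow> (x, z) \<in> rtrancl_on (A \<union> C - S) E \<Longrightarrow> z = x"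
      and T: "T = insert x S"
      by (auto simp: step_on_def forces_on_def)
    \<comment> \<open>Only a new vertex of \<open>A\<close> not yet in \<open>S'\<close> needs a
      step in \<open>A\<close>. Otherwise \<open>S'\<close> is kept, and it remains to see that
      \<open>v\<close> is in it when the new vertex is in \<open>C - A\<close>: the forcing vertex
      is then \<open>v\<close> itself or an earlier black vertex of \<open>C - A\<close>.\<close>
    show ?case
    proof (cases "x \<in> A \<and> x \<notin> S'")
      case False
      have "v \<in> S'" if "x \<in> C - A"
      proof (cases "y \<in> A")
        case True
        then have "y = v" using that f(3) by (intro edge_leaving) auto
        then show ?thesis using f(1) S'(3) vA by auto
      next
        case False
        then show ?thesis using S'(4) f(1,3) edges by auto
      qed
      then show ?thesis using S' False f(2) unfolding T by (intro exI[of _ S']) auto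
    next
      case True
      \<comment> \<open>A force entering \<open>A\<close> from outside has target \<open>v\<close>,
        but its source is a black vertex of \<open>C - A\<close>, so the invariant already has
        \<open>v\<close> in \<open>S'\<close>.\<close>
      have "y \<in> A"
      proof (rule ccontr)
        assume "y \<notin> A"
        then have "y \<in> C" "x = v" using f(3) True edges edge_entering by auto
        then show False using S'(4) \<open>y \<notin> A\<close> f(1) True by auto
      qed
      then have "y \<in> S'" using f(1) S'(3) by auto
      \<comment> \<open>The white set \<open>A - S'\<close> lies in \<open>A \<union> C - S\<close>,
        so the uniqueness known in the sum applies.\<close>
      moreover have "z = x" if "(y, z) \<in> E" "(x, z) \<in> rtrancl_on (A - S') E" for z
      proof (rule f(4)[OF that(1)])
        show "(x, z) \<in> rtrancl_on (A \<union> C - S) E"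
          using that(2) by (rule rtrancl_on_mono[rotated 2]) (use S'(3) in auto)
      qed
      ultimately have "step_on A E S' (insert x S')"
        unfolding step_on_def forces_on_def using True f(3) by blast
      with S'(1) have "(step_on A E)\<^sup>*\<^sup>* ?B (insert x S')" by (rule rtranclp.rtrancl_into_rtrancl)
      then show ?thesis using S' True unfolding T by (intro exI[of _ "insert x S'"]) auto
    qed
  qed
  from this[OF reach] obtain S' where "(step_on A E)\<^sup>*\<^sup>* ?B S'" "S' = A" by blast
  then show "forcing_set_on A E ?B" using vA by (auto simp: forcing_set_on_def)
qed

text \<open>A second white neighbour of \<open>u\<close> inside \<open>A\<close> is excluded by
  retracting the white walk to \<open>A\<close>. One outside \<open>A\<close> would make
  \<open>u = v\<close>, and a white walk from \<open>w\<close> to it would pass through the black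
  vertex \<open>v\<close>.\<close>

lemma step_on_extend:
  assumes "step_on A E S T" "S \<subseteq> A"
  shows "step_on (A \<union> C) E S T"
proof -
  from assms(1) obtain u w where f: "u \<in> S" "w \<in> A - S" "(u, w) \<in> E"
    "\<And>z. (u, z) \<in> E \<Longrightarrow> (w, z) \<in> rtrancl_on (A - S) E \<Longrightarrow> z = w" and T: "T = insert w S"
    by (auto simp: step_on_def forces_on_def)
  have "z = w" if z: "(u, z) \<in> E" "(w, z) \<in> rtrancl_on (A \<union> C - S) E" for z
  proof (cases "z \<in> A")
    case True
    have "(w, z) \<in> rtrancl_on ((A \<union> C - S) \<inter> A) E"
      using z(2) f(2) True by (intro rtrancl_on_retract_in) auto
    moreover have "(A \<union> C - S) \<inter> A = A - S" by auto
    ultimately show ?thesis using f(4) z(1) by simp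
  next
    case False
    then have "u = v" using z(1) f(1) assms(2) by (intro edge_leaving) auto
    then show ?thesis using rtrancl_on_retract_out[OF z(2)] f False by auto
  qed
  then show ?thesis unfolding step_on_def forces_on_def using f T by blast
qed

lemma forcing_tree:
  assumes "finite C" "is_tree_on C E" "A \<subseteq> S" "S \<subseteq> A \<union> C"
  shows "(step_on (A \<union> C) E)\<^sup>*\<^sup>* S (A \<union> C)"
  using assms(3,4)
proof (induct "card (C - S)" arbitrary: S rule: less_induct)
  case less
  show ?case
  proof (cases "S = A \<union> C")
    case False
    then obtain c where c: "c \<in> C" "c \<notin> S" using less.prems by auto
    have v: "v \<in> C" "v \<in> S" using inter less.prems by auto
    \<comment> \<open>A walk in the tree from the black vertex \<open>v\<close> to the white vertex
      \<open>c\<close> has to cross from black to white.\<close>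
    have "\<exists>u l. u \<in> S \<and> l \<notin> S \<and> u \<in> C \<and> l \<in> C \<and> (u, l) \<in> E"
    proof (rule ccontr)
      assume no: "\<not> ?thesis"
      have "(v, c) \<in> rtrancl_on C E" using assms(2) v c by (auto simp: is_tree_on_def)
      then have "c \<in> S" by (induct rule: rtrancl_on_induct) (use v no in auto)
      then show False using c by simp
    qed
    then obtain u l where ul: "u \<in> S" "l \<notin> S" "u \<in> C" "l \<in> C" "(u, l) \<in> E" by blast
    have "z = l" if z: "(u, z) \<in> E" "(l, z) \<in> rtrancl_on (A \<union> C - S) E" for z
    proof -
      \<comment> \<open>All of \<open>A\<close> is black, so white walks stay in \<open>C\<close>
        and avoid \<open>u\<close>; the acyclicity clause at \<open>u\<close> then identifies its
        neighbours \<open>l\<close> and \<open>z\<close>.\<close>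
      have "(l, z) \<in> rtrancl_on (C - {u}) E"
        using z(2) by (rule rtrancl_on_mono[rotated 2]) (use ul less.prems in auto)
      then show ?thesis using assms(2) ul z(1) unfolding is_tree_on_def by blast
    qed
    then have "step_on (A \<union> C) E S (insert l S)"
      unfolding step_on_def forces_on_def using ul by blast
    moreover have "(step_on (A \<union> C) E)\<^sup>*\<^sup>* (insert l S) (A \<union> C)"
    proof (rule less.hyps)
      show "card (C - insert l S) < card (C - S)"
        using assms(1) ul by (intro psubset_card_mono) auto
    qed (use less.prems ul in auto)
    ultimately show ?thesis by (rule converse_rtranclp_into_rtranclp)
  qed simp
qed

lemma forcing_set_on_extend:
  assumes B: "forcing_set_on A E B" and C: "finite C" "is_tree_on C E"
  shows "forcing_set_on (A \<union> C) E B"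
proof -
  have sub: "B \<subseteq> A" and reach: "(step_on A E)\<^sup>*\<^sup>* B A"
    using B by (auto simp: forcing_set_on_def)
  have "(step_on (A \<union> C) E)\<^sup>*\<^sup>* B D \<and> D \<subseteq> A" if "(step_on A E)\<^sup>*\<^sup>* B D" for D
    using that
  proof induct
    case (step S T)
    then show ?case using step_on_extend step_on_subset
      by (meson rtranclp.rtrancl_into_rtrancl)
  qed (use sub in auto)
  from this[OF reach] have "(step_on (A \<union> C) E)\<^sup>*\<^sup>* B A" ..
  moreover have "(step_on (A \<union> C) E)\<^sup>*\<^sup>* A (A \<union> C)"
    using C by (intro forcing_tree) auto
  ultimately show ?thesis using sub by (auto simp: forcing_set_on_def)
qed

end


section \<open>The vertex-sum as a gluing of two embedded graphs\<close>

theorem theorem6p8: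
  fixes G :: "'a pair_pre_digraph" and T :: "'b pair_pre_digraph" and v :: 'a and w :: 'b
  assumes "pair_graph G" and "v \<in> pverts G"
    and "pair_graph T" and "undirected_tree (with_proj T)" and "w \<in> pverts T"
  shows "Z_plus (with_proj (vertex_sum G v T w)) = Z_plus (with_proj G) \<and>
         tree_cover_number (with_proj (vertex_sum G v T w)) = tree_cover_number (with_proj G)"
proof -
  interpret G: pair_graph G by fact
  interpret T: pair_graph T by fact
  let ?S = "vertex_sum G v T w"
  have S: "pair_graph ?S" using assms(1,3) by (rule pair_graph_vertex_sum)
  define E where "E = parcs ?S"
  define A :: "('a + 'b) set" where "A = Inl ` pverts G"
  define C where "C = glue v w ` pverts T"
  have V: "pverts ?S = A \<union> C" by (simp add: vertex_sum_def A_def C_def)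
  have E: "E = map_prod Inl Inl ` parcs G \<union> map_prod (glue v w) (glue v w) ` parcs T"
    by (simp add: vertex_sum_def E_def)
  have glue_Inl: "glue v w y = Inl x \<longleftrightarrow> y = w \<and> x = v" for x y
    by (auto simp: glue_def)
  interpret gluing A C "Inl v" E
  proof
    show "E \<subseteq> A \<times> A \<union> C \<times> C"
      by (auto simp: E A_def C_def dest: G.wellformed' T.wellformed')
    show "A \<inter> C = {Inl v}"
      using assms(2,5) by (auto simp: A_def C_def glue_def)
  qed
  interpret Inl: embedding Inl "pverts G" "parcs G" E
  proof
    \<comment> \<open>An arc coming from \<open>T\<close> with both ends in the image of
      \<open>Inl\<close> would be a loop at \<open>w\<close>.\<close>
    show "(Inl x, Inl y) \<in> E \<longleftrightarrow> (x, y) \<in> parcs G" for x y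
      by (auto simp: E glue_Inl eq_commute[of "Inl _" "glue v w _"] dest: T.no_loops')
  qed simp
  interpret glue: embedding "glue v w" "pverts T" "parcs T" E
  proof
    \<comment> \<open>Likewise, an arc coming from \<open>G\<close> with both ends in the image of
      \<open>glue v w\<close> would be a loop at \<open>v\<close>.\<close>
    show "(glue v w x, glue v w y) \<in> E \<longleftrightarrow> (x, y) \<in> parcs T" for x y
      by (auto simp: E glue_Inl inj_eq[OF inj_glue] dest: G.no_loops')
  qed (rule inj_glue)
  have tree: "is_tree_on C E"
    unfolding C_def glue.is_tree_on_image_iff[OF subset_refl]
    using assms(4) undirected_tree_pair_iff[OF assms(3)] by simp
  have fin: "finite A" "finite C"
    using G.pair_finite_verts T.pair_finite_verts by (auto simp: A_def C_def)
  have "Z_plus (with_proj ?S) = (LEAST k. \<exists>B. forcing_set_on (A \<union> C) E B \<and> card B = k)"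
    unfolding Z_plus_def positive_zero_forcing_set_iff[OF S] V E_def ..
  also have "\<dots> = (LEAST k. \<exists>B. forcing_set_on A E B \<and> card B = k)"
    using forcing_set_on_restrict forcing_set_on_extend fin tree
    by (intro Least_card_eqI) auto
  also have "\<dots> = Z_plus (with_proj G)"
    unfolding A_def Inl.Least_forcing_set_image Z_plus_def
      positive_zero_forcing_set_iff[OF assms(1)] ..
  finally have Z: "Z_plus (with_proj ?S) = Z_plus (with_proj G)" .
  have "tree_cover_number (with_proj ?S) = (LEAST k. \<exists>P. tree_cover_on (A \<union> C) E P \<and> card P = k)"
    unfolding tree_cover_number_def induced_tree_cover_iff[OF S] V E_def ..
  also have "\<dots> = (LEAST k. \<exists>P. tree_cover_on A E P \<and> card P = k)"
    using tree_cover_on_restrict tree_cover_on_extend fin tree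
    by (intro Least_card_eqI) auto
  also have "\<dots> = tree_cover_number (with_proj G)"
    unfolding A_def Inl.Least_tree_cover_image tree_cover_number_def
      induced_tree_cover_iff[OF assms(1)] ..
  finally show ?thesis using Z by simp
qed

end
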